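(* Fix a level $c$ of $C$. Assume that for all $a,a^*\in\{0,1\}$ and all $m$, $$Y_{am}\perp A\mid (C,U),\quad Y_{am}\perp M\mid (A,C,U),\quad M_a\perp A\mid (C,U),\quad Y_{am}\perp M_{a^*}\mid (C,U),$$ and that $A\perp U\mid C$. Then the true conditional natural direct effect on the risk difference scale satisfies $$\mathrm{NDE}^{\mathrm{true}}_{\mathrm{RD}|c}\;\ge\;\sum_m P(Y=1\mid A=1,m,c)\,P(m\mid A=0,c)\big/\mathrm{BF}_{U|(M,c)}\;-\;P(Y=1\mid A=0,c),$$ and this bound is sharp, i.e. attainable: for all finite $\gamma,\delta\ge 1$ there is a joint distribution satisfying all the assumptions, with $\mathrm{RR}_{AU|(M,c)}=\gamma$ and $\mathrm{RR}_{UY|(A=1,M,c)}=\delta$, for which equality holds.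
   Context: Setting. $A\in\{0,1\}$ is a binary exposure, $Y\in\{0,1\}$ a binary outcome, $M$ a categorical mediator, $C$ categorical observed baseline covariates and $U$ categorical unmeasured baseline covariates ($M$, $C$, $U$ take finitely many values; they may be vectors). $Y_a$ and $M_a$ are the potential outcome and potential mediator under exposure $a$; $Y_{am}$ is the potential outcome under exposure $a$ and mediator value $m$; $Y_{aM_{a^*}}$ is the potential outcome under exposure $a$ with the mediator set to $M_{a^*}$. Consistency: $Y_a=Y$ and $M_a=M$ if $A=a$; $Y_{am}=Y$ if $A=a$ and $M=m$. Composition: $Y_{aM_a}=Y_a$ for $a=0,1$. The symbol $\perp$ denotes (conditional) independence; lower-case $m,c,u$ in conditional probabilities stand for the events $M=m$, $C=c$, $U=u$. Effect. $\mathrm{NDE}^{\mathrm{true}}_{\mathrm{RD}|c}=P(Y_{1M_0}=1\mid c)-P(Y_{0M_0}=1\mid c)$. Sensitivity parameters. $$\mathrm{RR}_{UY|(A=1,M,c)}=\max_m\frac{\max_u P(Y=1\mid A=1,m,c,u)}{\min_u P(Y=1\mid A=1,m,c,u)},\qquad \mathrm{RR}_{AU|(M,c)}=\max_m\max_u\frac{P(u\mid A=1,m,c)}{P(u\mid A=0,m,c)}.$$ Bounding factor: $$\mathrm{BF}_{U|(M,c)}=\frac{\mathrm{RR}_{AU|(M,c)}\times \mathrm{RR}_{UY|(A=1,M,c)}}{\mathrm{RR}_{AU|(M,c)}+\mathrm{RR}_{UY|(A=1,M,c)}-1}.$$ Conventions. $P(C=c)>0$, $P(A=a\mid c)>0$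 for $a=0,1$, and $P(m\mid A=1,c)>0$ whenever $P(m\mid A=0,c)>0$. Maxima over $m$ are over $m$ with $P(m\mid A=0,c)>0$, and the sum over $m$ is over the same values; $u$ ranges over values with $P(u\mid c)>0$. $P(Y=1\mid A=a,m,c,u)$ is understood as $P(Y_{am}=1\mid c,u)$ (with which it coincides under the independence assumptions) when its conditioning event has probability zero. A positive number over $0$ is $+\infty$; ratios $0/0$ are omitted from the maximum defining $\mathrm{RR}_{AU|(M,c)}$ and are read as $1$ in $\mathrm{RR}_{UY|(A=1,M,c)}$. If exactly one sensitivity parameter is infinite, $\mathrm{BF}_{U|(M,c)}$ equals the other; if both are, $\mathrm{BF}_{U|(M,c)}=\infty$ and $x/\infty=0$. *)

theory Defs
  imports "HOL-Probability.Probability"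
begin

(* Binary variables are bool-valued, with True for the value 1.
   Y_{aM_{a*}} is not a separate field: it is the nested counterfactual YaM below. *)
record ('w, 'm, 'c, 'u) causal_model =
  Pr  :: "'w measure"
  Av  :: "'w \<Rightarrow> bool"
  Yv  :: "'w \<Rightarrow> bool"
  Mv  :: "'w \<Rightarrow> 'm"
  Cv  :: "'w \<Rightarrow> 'c"
  Uv  :: "'w \<Rightarrow> 'u"
  Ya  :: "bool \<Rightarrow> 'w \<Rightarrow> bool"
  Ma  :: "bool \<Rightarrow> 'w \<Rightarrow> 'm"
  Yam :: "bool \<Rightarrow> 'm \<Rightarrow> 'w \<Rightarrow> bool"

definition YaM :: "('w, 'm, 'c, 'u) causal_model \<Rightarrow> bool \<Rightarrow> bool \<Rightarrow> 'w \<Rightarrow> bool" where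
  "YaM S a a' \<omega> = Yam S a (Ma S a' \<omega>) \<omega>"

abbreviation prob_of :: "('w, 'm, 'c, 'u) causal_model \<Rightarrow> ('w \<Rightarrow> bool) \<Rightarrow> real" where
  "prob_of S E \<equiv> measure (Pr S) {\<omega> \<in> space (Pr S). E \<omega>}"

abbreviation cprob :: "('w, 'm, 'c, 'u) causal_model \<Rightarrow> ('w \<Rightarrow> bool) \<Rightarrow> ('w \<Rightarrow> bool) \<Rightarrow> real" where
  "cprob S \<equiv> cond_prob (Pr S)"

definition random_vars :: "('w, 'm, 'c, 'u) causal_model \<Rightarrow> bool" where
  "random_vars S \<longleftrightarrow>
     prob_space (Pr S) \<and>
     Av S \<in> measurable (Pr S) (count_space UNIV) \<and>
     Yv S \<in> measurable (Pr S) (count_space UNIV) \<and>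
     Mv S \<in> measurable (Pr S) (count_space UNIV) \<and>
     Cv S \<in> measurable (Pr S) (count_space UNIV) \<and>
     Uv S \<in> measurable (Pr S) (count_space UNIV) \<and>
     (\<forall>a. Ya S a \<in> measurable (Pr S) (count_space UNIV)) \<and>
     (\<forall>a. Ma S a \<in> measurable (Pr S) (count_space UNIV)) \<and>
     (\<forall>a m. Yam S a m \<in> measurable (Pr S) (count_space UNIV))"

definition consistency :: "('w, 'm, 'c, 'u) causal_model \<Rightarrow> bool" where
  "consistency S \<longleftrightarrow>
     (\<forall>\<omega> \<in> space (Pr S). \<forall>a. Av S \<omega> = a \<longrightarrow>
        Ya S a \<omega> = Yv S \<omega> \<and> Ma S a \<omega> = Mv S \<omega> \<and>
        (\<forall>m. Mv S \<omega> = m \<longrightarrow> Yam S a m \<omega> = Yv S \<omega>))"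

definition composition :: "('w, 'm, 'c, 'u) causal_model \<Rightarrow> bool" where
  "composition S \<longleftrightarrow> (\<forall>\<omega> \<in> space (Pr S). \<forall>a. YaM S a a \<omega> = Ya S a \<omega>)"

(* All variables involved are discrete, so factorisation of the conditional point
   probabilities is conditional independence. *)
definition cond_indep ::
  "'w measure \<Rightarrow> ('w \<Rightarrow> 'x) \<Rightarrow> ('w \<Rightarrow> 'y) \<Rightarrow> ('w \<Rightarrow> 'z) \<Rightarrow> bool" where
  "cond_indep P X1 X2 Z \<longleftrightarrow>
     (\<forall>x y z. measure P {\<omega> \<in> space P. Z \<omega> = z} > 0 \<longrightarrow>
        cond_prob P (\<lambda>\<omega>. X1 \<omega> = x \<and> X2 \<omega> = y) (\<lambda>\<omega>. Z \<omega> = z) =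
        cond_prob P (\<lambda>\<omega>. X1 \<omega> = x) (\<lambda>\<omega>. Z \<omega> = z) *
        cond_prob P (\<lambda>\<omega>. X2 \<omega> = y) (\<lambda>\<omega>. Z \<omega> = z))"

definition independence_assumptions :: "('w, 'm, 'c, 'u) causal_model \<Rightarrow> bool" where
  "independence_assumptions S \<longleftrightarrow>
     (\<forall>a a' m.
        cond_indep (Pr S) (Yam S a m) (Av S) (\<lambda>\<omega>. (Cv S \<omega>, Uv S \<omega>)) \<and>
        cond_indep (Pr S) (Yam S a m) (Mv S) (\<lambda>\<omega>. (Av S \<omega>, Cv S \<omega>, Uv S \<omega>)) \<and>
        cond_indep (Pr S) (Ma S a) (Av S) (\<lambda>\<omega>. (Cv S \<omega>, Uv S \<omega>)) \<and>
        cond_indep (Pr S) (Yam S a m) (Ma S a') (\<lambda>\<omega>. (Cv S \<omega>, Uv S \<omega>))) \<and>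
     cond_indep (Pr S) (Av S) (Uv S) (Cv S)"

definition positivity :: "('w, 'm, 'c, 'u) causal_model \<Rightarrow> 'c \<Rightarrow> bool" where
  "positivity S c \<longleftrightarrow>
     prob_of S (\<lambda>\<omega>. Cv S \<omega> = c) > 0 \<and>
     (\<forall>a. cprob S (\<lambda>\<omega>. Av S \<omega> = a) (\<lambda>\<omega>. Cv S \<omega> = c) > 0) \<and>
     (\<forall>m. cprob S (\<lambda>\<omega>. Mv S \<omega> = m) (\<lambda>\<omega>. \<not> Av S \<omega> \<and> Cv S \<omega> = c) > 0 \<longrightarrow>
          cprob S (\<lambda>\<omega>. Mv S \<omega> = m) (\<lambda>\<omega>. Av S \<omega> \<and> Cv S \<omega> = c) > 0)"

definition nde_rd :: "('w, 'm, 'c, 'u) causal_model \<Rightarrow> 'c \<Rightarrow> real" where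
  "nde_rd S c =
     cprob S (\<lambda>\<omega>. YaM S True False \<omega>) (\<lambda>\<omega>. Cv S \<omega> = c) -
     cprob S (\<lambda>\<omega>. YaM S False False \<omega>) (\<lambda>\<omega>. Cv S \<omega> = c)"

definition m_levels :: "('w, 'm, 'c, 'u) causal_model \<Rightarrow> 'c \<Rightarrow> 'm set" where
  "m_levels S c = {m. cprob S (\<lambda>\<omega>. Mv S \<omega> = m) (\<lambda>\<omega>. \<not> Av S \<omega> \<and> Cv S \<omega> = c) > 0}"

definition u_levels :: "('w, 'm, 'c, 'u) causal_model \<Rightarrow> 'c \<Rightarrow> 'u set" where
  "u_levels S c = {u. cprob S (\<lambda>\<omega>. Uv S \<omega> = u) (\<lambda>\<omega>. Cv S \<omega> = c) > 0}"

(* P(Y=1 | A=a, m, c, u), read as P(Y_{am}=1 | c, u) when the conditioning event is null. *)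
definition outcome_prob ::
  "('w, 'm, 'c, 'u) causal_model \<Rightarrow> bool \<Rightarrow> 'm \<Rightarrow> 'c \<Rightarrow> 'u \<Rightarrow> real" where
  "outcome_prob S a m c u =
     (if prob_of S (\<lambda>\<omega>. Av S \<omega> = a \<and> Mv S \<omega> = m \<and> Cv S \<omega> = c \<and> Uv S \<omega> = u) = 0
      then cprob S (\<lambda>\<omega>. Yam S a m \<omega>) (\<lambda>\<omega>. Cv S \<omega> = c \<and> Uv S \<omega> = u)
      else cprob S (\<lambda>\<omega>. Yv S \<omega>) (\<lambda>\<omega>. Av S \<omega> = a \<and> Mv S \<omega> = m \<and> Cv S \<omega> = c \<and> Uv S \<omega> = u))"

definition u_prob ::
  "('w, 'm, 'c, 'u) causal_model \<Rightarrow> bool \<Rightarrow> 'm \<Rightarrow> 'c \<Rightarrow> 'u \<Rightarrow> real" where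
  "u_prob S a m c u =
     cprob S (\<lambda>\<omega>. Uv S \<omega> = u) (\<lambda>\<omega>. Av S \<omega> = a \<and> Mv S \<omega> = m \<and> Cv S \<omega> = c)"

(* Division on ereal gives p / 0 = \<infinity> for p > 0; only 0 / 0 needs a separate convention. *)
definition rr_uy :: "('w, 'm, 'c, 'u) causal_model \<Rightarrow> 'c \<Rightarrow> ereal" where
  "rr_uy S c =
     Max ((\<lambda>m. let hi = Max (outcome_prob S True m c ` u_levels S c);
                   lo = Min (outcome_prob S True m c ` u_levels S c)
               in if hi = 0 \<and> lo = 0 then 1 else ereal hi / ereal lo) ` m_levels S c)"

definition rr_au :: "('w, 'm, 'c, 'u) causal_model \<Rightarrow> 'c \<Rightarrow> ereal" where
  "rr_au S c =
     Max ((\<lambda>m. Max ((\<lambda>u. ereal (u_prob S True m c u) / ereal (u_prob S False m c u)) `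
                   {u \<in> u_levels S c. \<not> (u_prob S True m c u = 0 \<and> u_prob S False m c u = 0)}))
          ` m_levels S c)"

definition bf :: "('w, 'm, 'c, 'u) causal_model \<Rightarrow> 'c \<Rightarrow> ereal" where
  "bf S c =
     (if rr_au S c = \<infinity> then rr_uy S c
      else if rr_uy S c = \<infinity> then rr_au S c
      else rr_au S c * rr_uy S c / (rr_au S c + rr_uy S c - 1))"

(* Division on ereal gives x / \<infinity> = 0. *)
definition nde_rd_bound :: "('w, 'm, 'c, 'u) causal_model \<Rightarrow> 'c \<Rightarrow> ereal" where
  "nde_rd_bound S c =
     (\<Sum>m \<in> m_levels S c.
        ereal (cprob S (\<lambda>\<omega>. Yv S \<omega>) (\<lambda>\<omega>. Av S \<omega> \<and> Mv S \<omega> = m \<and> Cv S \<omega> = c) *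
               cprob S (\<lambda>\<omega>. Mv S \<omega> = m) (\<lambda>\<omega>. \<not> Av S \<omega> \<and> Cv S \<omega> = c)) / bf S c)
     - ereal (cprob S (\<lambda>\<omega>. Yv S \<omega>) (\<lambda>\<omega>. \<not> Av S \<omega> \<and> Cv S \<omega> = c))"

definition assumptions :: "('w, 'm, 'c, 'u) causal_model \<Rightarrow> 'c \<Rightarrow> bool" where
  "assumptions S c \<longleftrightarrow>
     random_vars S \<and> consistency S \<and> composition S \<and>
     independence_assumptions S \<and> positivity S c"

end

theory Submission
  imports Defs
begin

text \<open>
  Write \<open>q m u\<close> for \<open>P(Y\<^sub>1\<^sub>m = 1 | c, u)\<close>. The independences given \<open>(C, U)\<close> say that, once \<open>U\<close>
  is known, the cross-world event \<open>Y\<^sub>1\<^sub>m = 1, M\<^sub>0 = m\<close> has the product of two probabilities that are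
  both factual: the outcome one under exposure 1 and the mediator one under exposure 0. Since
  exposure is independent of \<open>U\<close> given \<open>C\<close>, the law of \<open>U\<close> may be taken given \<open>A = 0\<close>, and so
  (\<open>nde_rd_identification\<close>)
  the first term of the effect is the average, over \<open>m\<close> drawn from the law of \<open>M\<close> given \<open>A = 0, c\<close>,
  of the mean of \<open>q m\<close> under the law \<open>p\<^sub>0\<close> of \<open>U\<close> given \<open>A = 0, m, c\<close>. The same computation
  with exposure 0 in both worlds turns the second term into \<open>P(Y = 1 | A = 0, c)\<close>.

  The observable quantity \<open>P(Y = 1 | A = 1, m, c)\<close> is the mean of the same function \<open>q m\<close> under the
  law \<open>p\<^sub>1\<close> of \<open>U\<close> given \<open>A = 1, m, c\<close>. So everything reduces to comparing, for each \<open>m\<close>,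
  two means of one function under two laws. If \<open>p\<^sub>1 \<le> \<gamma> p\<^sub>0\<close> pointwise and \<open>q\<close> varies by a factor of
  at most \<open>\<delta>\<close>, the means differ by a factor of at most \<open>\<gamma> \<delta> / (\<gamma> + \<delta> - 1)\<close>
  (\<open>bounding_factor_inequality\<close>); infinite \<open>\<gamma>\<close> or \<open>\<delta>\<close> leave the other as the factor.

  For \<open>\<gamma> > 1\<close>, equality asks for \<open>p\<^sub>1\<close> concentrated where \<open>q\<close> is maximal, and for \<open>p\<^sub>0\<close> giving that set
  mass \<open>1 / \<gamma>\<close> and the rest of its mass to the minimum of \<open>q\<close>. Since \<open>A\<close> and \<open>U\<close> are independent, the
  exposed subjects with minimal \<open>q\<close> must have a mediator value that no unexposed subject has. So all
  unexposed subjects get one value \<open>m\<^sub>0\<close>, and exposed ones get \<open>m\<^sub>0\<close> exactly if \<open>U = 1\<close>; the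
  other mediator value never enters the bound. For \<open>\<gamma> = 1\<close> the bounding factor is 1, and
  a constant mediator gives equality.
\<close>

section \<open>The bounding factor inequality\<close>

lemma mean_le_upper_bound:
  fixes p q :: "'u \<Rightarrow> real"
  assumes "\<And>u. u \<in> V \<Longrightarrow> 0 \<le> p u" "sum p V = 1"
    and "\<And>u. u \<in> V \<Longrightarrow> q u \<le> B"
  shows "(\<Sum>u\<in>V. q u * p u) \<le> B"
proof -
  have "(\<Sum>u\<in>V. q u * p u) \<le> (\<Sum>u\<in>V. B * p u)"
    using assms by (intro sum_mono mult_right_mono) auto
  also have "\<dots> = B" using assms(2) by (simp flip: sum_distrib_left)
  finally show ?thesis .
qed

text \<open>
  With \<open>lo\<close> the minimum of \<open>q\<close>, the excess \<open>q - lo\<close> is nonnegative, so its mean grows by at most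
  the factor \<open>\<gamma>\<close> when passing from \<open>p0\<close> to \<open>p1\<close>, whereas the constant part \<open>lo\<close> does not change
  at all. As \<open>lo\<close> is at least \<open>1 / \<delta>\<close> times any mean of \<open>q\<close>, the constant part is not
  negligible, which lowers the trivial factor \<open>\<gamma>\<close> to the bounding factor.
\<close>

lemma bounding_factor_inequality:
  fixes p0 p1 q :: "'u \<Rightarrow> real"
  assumes "finite V" "V \<noteq> {}"
    and p0: "\<And>u. u \<in> V \<Longrightarrow> 0 \<le> p0 u" "sum p0 V = 1"
    and p1: "\<And>u. u \<in> V \<Longrightarrow> 0 \<le> p1 u" "sum p1 V = 1"
    and \<gamma>: "\<And>u. u \<in> V \<Longrightarrow> p1 u \<le> \<gamma> * p0 u" "1 \<le> \<gamma>"
    and \<delta>: "\<And>u v. u \<in> V \<Longrightarrow> v \<in> V \<Longrightarrow> q u \<le> \<delta> * q v" "1 \<le> \<delta>"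
  shows "(\<gamma> + \<delta> - 1) * (\<Sum>u\<in>V. q u * p1 u) \<le> \<gamma> * \<delta> * (\<Sum>u\<in>V. q u * p0 u)"
proof -
  define E0 E1 where "E0 = (\<Sum>u\<in>V. q u * p0 u)" and "E1 = (\<Sum>u\<in>V. q u * p1 u)"
  define lo where "lo = Min (q ` V)"
  have "lo \<in> q ` V" unfolding lo_def using assms(1,2) by (intro Min_in) auto
  then obtain v where v: "v \<in> V" "lo = q v" by auto
  have lo: "lo \<le> q u" if "u \<in> V" for u using that assms(1) by (simp add: lo_def)
  have E1_le: "E1 \<le> \<delta> * lo"
    unfolding E1_def using p1 \<delta>(1) v by (intro mean_le_upper_bound) auto
  have "(\<Sum>u\<in>V. (q u - lo) * p1 u) \<le> (\<Sum>u\<in>V. (q u - lo) * (\<gamma> * p0 u))"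
    using lo \<gamma>(1) by (intro sum_mono mult_left_mono) auto
  also have "\<dots> = \<gamma> * (\<Sum>u\<in>V. (q u - lo) * p0 u)"
    by (simp add: sum_distrib_left mult_ac)
  finally have "E1 - lo \<le> \<gamma> * (E0 - lo)"
    using p0(2) p1(2)
    by (simp add: E0_def E1_def left_diff_distrib sum_subtractf flip: sum_distrib_left)
  hence "\<delta> * (E1 + (\<gamma> - 1) * lo) \<le> \<delta> * (\<gamma> * E0)"
    using \<delta>(2) by (intro mult_left_mono) (auto simp: algebra_simps)
  moreover have "(\<gamma> - 1) * E1 \<le> (\<gamma> - 1) * (\<delta> * lo)"
    using \<gamma>(2) E1_le by (intro mult_left_mono) auto
  ultimately show ?thesis
    unfolding E0_def[symmetric] E1_def[symmetric] by (simp add: algebra_simps)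
qed

text \<open>
  As a positive number over 0 exceeds every finite bound, a finite sensitivity parameter is a
  genuine multiplicative bound, also where a denominator vanishes.
\<close>

lemma le_mult_if_ereal_divide_le:
  assumes "ereal x / ereal y \<le> ereal r" "0 \<le> x" "0 \<le> y" "\<not> (x = 0 \<and> y = 0)"
  shows "x \<le> r * y"
  using assms by (cases "y = 0") (auto simp: divide_le_eq)

section \<open>Identification of nested counterfactuals\<close>

text \<open>
  Clearing denominators makes conditional independence an identity that also holds on null
  conditioning events, where all its terms vanish.
\<close>

lemma cond_indep_joint:
  assumes "prob_space P" "cond_indep P X1 X2 Z"
    and [measurable]: "X1 \<in> measurable P (count_space UNIV)"
      "X2 \<in> measurable P (count_space UNIV)" "Z \<in> measurable P (count_space UNIV)"
  shows "measure P {\<omega> \<in> space P. X1 \<omega> = x \<and> X2 \<omega> = y \<and> Z \<omega> = z} *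
           measure P {\<omega> \<in> space P. Z \<omega> = z} =
         measure P {\<omega> \<in> space P. X1 \<omega> = x \<and> Z \<omega> = z} *
           measure P {\<omega> \<in> space P. X2 \<omega> = y \<and> Z \<omega> = z}"
proof (cases "measure P {\<omega> \<in> space P. Z \<omega> = z} = 0")
  case True
  interpret prob_space P by fact
  have "measure P {\<omega> \<in> space P. X1 \<omega> = x \<and> Z \<omega> = z} \<le> measure P {\<omega> \<in> space P. Z \<omega> = z}"
    by (intro finite_measure_mono) auto
  thus ?thesis using True by (simp add: measure_le_0_iff)
next
  case False
  hence "measure P {\<omega> \<in> space P. Z \<omega> = z} > 0" by (simp add: zero_less_measure_iff)
  with assms(2) False show ?thesis
    unfolding cond_indep_def cond_prob_def by (auto simp: divide_simps conj_ac)
qed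

lemma (in prob_space) prob_sum_over_values:
  fixes X :: "'a \<Rightarrow> 'x::finite"
  assumes [measurable]: "X \<in> measurable M (count_space UNIV)" "Measurable.pred M E"
  shows "prob {\<omega> \<in> space M. E \<omega>} = (\<Sum>x\<in>UNIV. prob {\<omega> \<in> space M. E \<omega> \<and> X \<omega> = x})"
proof -
  have "{\<omega> \<in> space M. E \<omega>} = (\<Union>x. {\<omega> \<in> space M. E \<omega> \<and> X \<omega> = x})" by auto
  also have "prob \<dots> = (\<Sum>x\<in>UNIV. prob {\<omega> \<in> space M. E \<omega> \<and> X \<omega> = x})"
    by (intro finite_measure_finite_Union) (auto simp: disjoint_family_on_def)
  finally show ?thesis .
qed

locale mediation_model =
  fixes S :: "('w, 'm::finite, 'c::finite, 'u::finite) causal_model" and c :: 'c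
  assumes assms: "assumptions S c"
begin

sublocale prob_space "Pr S"
  using assms by (simp add: assumptions_def random_vars_def)

lemma measurable_vars [measurable]:
  "Av S \<in> measurable (Pr S) (count_space UNIV)"
  "Yv S \<in> measurable (Pr S) (count_space UNIV)"
  "Mv S \<in> measurable (Pr S) (count_space UNIV)"
  "Cv S \<in> measurable (Pr S) (count_space UNIV)"
  "Uv S \<in> measurable (Pr S) (count_space UNIV)"
  "Ma S a \<in> measurable (Pr S) (count_space UNIV)"
  "Yam S a m \<in> measurable (Pr S) (count_space UNIV)"
  using assms by (simp_all add: assumptions_def random_vars_def)

lemma measurable_YaM [measurable]: "YaM S a a' \<in> measurable (Pr S) (count_space UNIV)"
  unfolding YaM_def[abs_def] by measurable

lemma prob_mono:
  assumes [measurable]: "Measurable.pred (Pr S) F" and "\<And>\<omega>. E \<omega> \<Longrightarrow> F \<omega>"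
  shows "prob_of S E \<le> prob_of S F"
  using assms by (intro finite_measure_mono) auto

lemma prob_null:
  assumes "prob_of S F = 0" "Measurable.pred (Pr S) F" "\<And>\<omega>. E \<omega> \<Longrightarrow> F \<omega>"
  shows "prob_of S E = 0"
  using prob_mono[OF assms(2,3)] assms(1) by (simp add: measure_le_0_iff)

lemma prob_C_pos: "prob_of S (\<lambda>\<omega>. Cv S \<omega> = c) > 0"
  using assms by (simp add: assumptions_def positivity_def)

lemma prob_AC_pos: "prob_of S (\<lambda>\<omega>. Av S \<omega> = a \<and> Cv S \<omega> = c) > 0"
  using assms prob_C_pos
  by (auto simp: assumptions_def positivity_def cond_prob_def zero_less_divide_iff)

lemma indeps:
  "cond_indep (Pr S) (Yam S a m) (Av S) (\<lambda>\<omega>. (Cv S \<omega>, Uv S \<omega>))"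
  "cond_indep (Pr S) (Yam S a m) (Mv S) (\<lambda>\<omega>. (Av S \<omega>, Cv S \<omega>, Uv S \<omega>))"
  "cond_indep (Pr S) (Ma S a) (Av S) (\<lambda>\<omega>. (Cv S \<omega>, Uv S \<omega>))"
  "cond_indep (Pr S) (Yam S a m) (Ma S a') (\<lambda>\<omega>. (Cv S \<omega>, Uv S \<omega>))"
  "cond_indep (Pr S) (Av S) (Uv S) (Cv S)"
  using assms by (simp_all add: assumptions_def independence_assumptions_def)

lemma factual_mediator:
  "prob_of S (\<lambda>\<omega>. Ma S a \<omega> = m \<and> Av S \<omega> = a \<and> Cv S \<omega> = c \<and> Uv S \<omega> = u) =
   prob_of S (\<lambda>\<omega>. Av S \<omega> = a \<and> Mv S \<omega> = m \<and> Cv S \<omega> = c \<and> Uv S \<omega> = u)"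
  using assms by (intro arg_cong[where f = "measure (Pr S)"])
    (auto simp: assumptions_def consistency_def)

lemma factual_outcome:
  "prob_of S (\<lambda>\<omega>. Yam S a m \<omega> \<and> Mv S \<omega> = m \<and> Av S \<omega> = a \<and> Cv S \<omega> = c \<and> Uv S \<omega> = u) =
   prob_of S (\<lambda>\<omega>. Yv S \<omega> \<and> Av S \<omega> = a \<and> Mv S \<omega> = m \<and> Cv S \<omega> = c \<and> Uv S \<omega> = u)"
  using assms by (intro arg_cong[where f = "measure (Pr S)"])
    (auto simp: assumptions_def consistency_def)

text \<open>
  Consistency replaces \<open>Y\<close> by \<open>Y\<^sub>a\<^sub>m\<close> on the event \<open>A = a, M = m\<close>; then the mediator and after it
  the exposure are dropped from the conditioning event. Stated for joint probabilities, the
  identity holds on null strata too, both sides being 0.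
\<close>

lemma joint_prob_by_counterfactual_outcome:
  "prob_of S (\<lambda>\<omega>. Yv S \<omega> \<and> Av S \<omega> = a \<and> Mv S \<omega> = m \<and> Cv S \<omega> = c \<and> Uv S \<omega> = u) =
   cprob S (\<lambda>\<omega>. Yam S a m \<omega>) (\<lambda>\<omega>. Cv S \<omega> = c \<and> Uv S \<omega> = u) *
   prob_of S (\<lambda>\<omega>. Av S \<omega> = a \<and> Mv S \<omega> = m \<and> Cv S \<omega> = c \<and> Uv S \<omega> = u)"
    (is "?y = ?q * ?n")
proof (cases "prob_of S (\<lambda>\<omega>. Av S \<omega> = a \<and> Cv S \<omega> = c \<and> Uv S \<omega> = u) = 0")
  case True
  have "?y = 0" "?n = 0" by (rule prob_null[OF True]; auto)+
  thus ?thesis by simp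
next
  case False
  let ?ac = "prob_of S (\<lambda>\<omega>. Av S \<omega> = a \<and> Cv S \<omega> = c \<and> Uv S \<omega> = u)"
  let ?c = "prob_of S (\<lambda>\<omega>. Cv S \<omega> = c \<and> Uv S \<omega> = u)"
  let ?yac = "prob_of S (\<lambda>\<omega>. Yam S a m \<omega> \<and> Av S \<omega> = a \<and> Cv S \<omega> = c \<and> Uv S \<omega> = u)"
  have c0: "?c \<noteq> 0"
  proof
    assume "?c = 0"
    then have "?ac = 0" by (rule prob_null) auto
    with False show False ..
  qed
  have swap: "?n = prob_of S (\<lambda>\<omega>. Mv S \<omega> = m \<and> Av S \<omega> = a \<and> Cv S \<omega> = c \<and> Uv S \<omega> = u)"
    by (simp only: conj_left_commute)
  have 1: "?y * ?ac = ?yac * ?n"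
    using cond_indep_joint[OF prob_space_axioms indeps(2), of a m True m "(a, c, u)"]
    by (simp add: factual_outcome swap)
  have 2: "?yac * ?c = prob_of S (\<lambda>\<omega>. Yam S a m \<omega> \<and> Cv S \<omega> = c \<and> Uv S \<omega> = u) * ?ac"
    using cond_indep_joint[OF prob_space_axioms indeps(1), of a m True a "(c, u)"] by simp
  have "?yac = ?q * ?ac" using 2 c0 by (simp add: cond_prob_def field_simps)
  with 1 show ?thesis using False by simp
qed

text \<open>Division by a positive stratum probability gives the factual branch of
  \<^const>\<open>outcome_prob\<close>; on a null stratum the equation is the convention itself.\<close>

lemma outcome_prob_eq_counterfactual:
  "outcome_prob S a m c u = cprob S (\<lambda>\<omega>. Yam S a m \<omega>) (\<lambda>\<omega>. Cv S \<omega> = c \<and> Uv S \<omega> = u)"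
  using joint_prob_by_counterfactual_outcome[of a m u]
  by (simp add: outcome_prob_def) (simp add: cond_prob_def)

lemma joint_outcome_prob:
  "prob_of S (\<lambda>\<omega>. Yv S \<omega> \<and> Av S \<omega> = a \<and> Mv S \<omega> = m \<and> Cv S \<omega> = c \<and> Uv S \<omega> = u) =
   outcome_prob S a m c u *
   prob_of S (\<lambda>\<omega>. Av S \<omega> = a \<and> Mv S \<omega> = m \<and> Cv S \<omega> = c \<and> Uv S \<omega> = u)"
  by (simp only: joint_prob_by_counterfactual_outcome outcome_prob_eq_counterfactual)

text \<open>
  Within a stratum of \<open>(C, U)\<close> the counterfactual mediator has the law of the factual one
  under \<open>A = a\<close>; independence of \<open>A\<close> and \<open>U\<close> then lets the weight of the stratum be measured
  among the subjects with \<open>A = a\<close>.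
\<close>

lemma counterfactual_mediator_prob:
  "prob_of S (\<lambda>\<omega>. Ma S a \<omega> = m \<and> Cv S \<omega> = c \<and> Uv S \<omega> = u) *
     prob_of S (\<lambda>\<omega>. Av S \<omega> = a \<and> Cv S \<omega> = c) =
   prob_of S (\<lambda>\<omega>. Av S \<omega> = a \<and> Mv S \<omega> = m \<and> Cv S \<omega> = c \<and> Uv S \<omega> = u) *
     prob_of S (\<lambda>\<omega>. Cv S \<omega> = c)" (is "?m * ?a = ?am * ?k")
proof (cases "prob_of S (\<lambda>\<omega>. Cv S \<omega> = c \<and> Uv S \<omega> = u) = 0")
  case True
  have "?m = 0" "?am = 0" by (rule prob_null[OF True]; auto)+
  thus ?thesis by simp
next
  case False
  let ?c = "prob_of S (\<lambda>\<omega>. Cv S \<omega> = c \<and> Uv S \<omega> = u)"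
  let ?ac = "prob_of S (\<lambda>\<omega>. Av S \<omega> = a \<and> Cv S \<omega> = c \<and> Uv S \<omega> = u)"
  have 1: "?am * ?c = ?m * ?ac"
    using cond_indep_joint[OF prob_space_axioms indeps(3), of a m a "(c, u)"]
    by (simp add: factual_mediator)
  have 2: "?ac * ?k = ?a * ?c"
    using cond_indep_joint[OF prob_space_axioms indeps(5), of a u c]
    by (simp add: conj_ac)
  have "?m * ?a * ?c = ?m * (?ac * ?k)" by (simp add: 2)
  also have "\<dots> = ?am * ?k * ?c" by (simp flip: 1 mult.assoc)
  finally show ?thesis using False by simp
qed

lemma cross_world_joint:
  "prob_of S (\<lambda>\<omega>. Yam S a m \<omega> \<and> Ma S a' \<omega> = m \<and> Cv S \<omega> = c \<and> Uv S \<omega> = u) =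
   outcome_prob S a m c u * prob_of S (\<lambda>\<omega>. Ma S a' \<omega> = m \<and> Cv S \<omega> = c \<and> Uv S \<omega> = u)"
    (is "?y = _ * ?m")
proof (cases "prob_of S (\<lambda>\<omega>. Cv S \<omega> = c \<and> Uv S \<omega> = u) = 0")
  case True
  have "?y = 0" "?m = 0" by (rule prob_null[OF True]; auto)+
  thus ?thesis by simp
next
  case False
  thus ?thesis
    using cond_indep_joint[OF prob_space_axioms indeps(4), of a m a' True m "(c, u)"]
    by (simp add: outcome_prob_eq_counterfactual cond_prob_def divide_simps)
qed

text \<open>
  On the right the two worlds are separated: the outcome law comes from exposure \<open>a\<close>, the joint law
  of mediator and \<open>U\<close> from exposure \<open>a'\<close>, and no quantity refers to both.
\<close>

lemma cross_world_identification:
  "cprob S (\<lambda>\<omega>. YaM S a a' \<omega>) (\<lambda>\<omega>. Cv S \<omega> = c) =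
   (\<Sum>m\<in>UNIV. \<Sum>u\<in>UNIV. outcome_prob S a m c u *
      prob_of S (\<lambda>\<omega>. Av S \<omega> = a' \<and> Mv S \<omega> = m \<and> Cv S \<omega> = c \<and> Uv S \<omega> = u)) /
   prob_of S (\<lambda>\<omega>. Av S \<omega> = a' \<and> Cv S \<omega> = c)"
proof -
  let ?k = "prob_of S (\<lambda>\<omega>. Cv S \<omega> = c)" and ?a = "prob_of S (\<lambda>\<omega>. Av S \<omega> = a' \<and> Cv S \<omega> = c)"
  let ?am = "\<lambda>m u. prob_of S (\<lambda>\<omega>. Av S \<omega> = a' \<and> Mv S \<omega> = m \<and> Cv S \<omega> = c \<and> Uv S \<omega> = u)"
  have pos: "?k > 0" "?a > 0" by (rule prob_C_pos prob_AC_pos)+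
  have "prob_of S (\<lambda>\<omega>. YaM S a a' \<omega> \<and> Cv S \<omega> = c) =
    (\<Sum>m\<in>UNIV. prob_of S (\<lambda>\<omega>. (YaM S a a' \<omega> \<and> Cv S \<omega> = c) \<and> Ma S a' \<omega> = m))"
    by (intro prob_sum_over_values) measurable
  also have "\<dots> = (\<Sum>m\<in>UNIV. \<Sum>u\<in>UNIV.
      prob_of S (\<lambda>\<omega>. ((YaM S a a' \<omega> \<and> Cv S \<omega> = c) \<and> Ma S a' \<omega> = m) \<and> Uv S \<omega> = u))"
    by (intro sum.cong refl prob_sum_over_values) measurable
  also have "\<dots> = (\<Sum>m\<in>UNIV. \<Sum>u\<in>UNIV.
      prob_of S (\<lambda>\<omega>. Yam S a m \<omega> \<and> Ma S a' \<omega> = m \<and> Cv S \<omega> = c \<and> Uv S \<omega> = u))"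
    by (intro sum.cong refl arg_cong[where f = "measure (Pr S)"]) (auto simp: YaM_def)
  also have "\<dots> = (\<Sum>m\<in>UNIV. \<Sum>u\<in>UNIV. outcome_prob S a m c u * (?am m u * ?k / ?a))"
  proof (intro sum.cong refl)
    fix m u
    have "prob_of S (\<lambda>\<omega>. Ma S a' \<omega> = m \<and> Cv S \<omega> = c \<and> Uv S \<omega> = u) = ?am m u * ?k / ?a"
      using counterfactual_mediator_prob[of a' m u] pos by (simp add: eq_divide_eq)
    thus "prob_of S (\<lambda>\<omega>. Yam S a m \<omega> \<and> Ma S a' \<omega> = m \<and> Cv S \<omega> = c \<and> Uv S \<omega> = u) =
        outcome_prob S a m c u * (?am m u * ?k / ?a)"
      by (simp only: cross_world_joint)
  qed
  also have "\<dots> = (\<Sum>m\<in>UNIV. \<Sum>u\<in>UNIV. outcome_prob S a m c u * ?am m u) / ?a * ?k"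
    by (simp add: sum_distrib_right sum_divide_distrib mult.assoc)
  finally show ?thesis using pos by (simp add: cond_prob_def)
qed

lemma joint_outcome_given_mediator:
  "prob_of S (\<lambda>\<omega>. Yv S \<omega> \<and> Av S \<omega> = a \<and> Mv S \<omega> = m \<and> Cv S \<omega> = c) =
   (\<Sum>u\<in>UNIV. outcome_prob S a m c u *
      prob_of S (\<lambda>\<omega>. Av S \<omega> = a \<and> Mv S \<omega> = m \<and> Cv S \<omega> = c \<and> Uv S \<omega> = u))"
proof -
  have "prob_of S (\<lambda>\<omega>. Yv S \<omega> \<and> Av S \<omega> = a \<and> Mv S \<omega> = m \<and> Cv S \<omega> = c) =
    (\<Sum>u\<in>UNIV. prob_of S (\<lambda>\<omega>. (Yv S \<omega> \<and> Av S \<omega> = a \<and> Mv S \<omega> = m \<and> Cv S \<omega> = c) \<and> Uv S \<omega> = u))"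
    by (intro prob_sum_over_values) measurable
  also have "\<dots> = (\<Sum>u\<in>UNIV. outcome_prob S a m c u *
      prob_of S (\<lambda>\<omega>. Av S \<omega> = a \<and> Mv S \<omega> = m \<and> Cv S \<omega> = c \<and> Uv S \<omega> = u))"
    by (intro sum.cong refl, subst joint_outcome_prob[symmetric]) (simp only: conj_ac)
  finally show ?thesis .
qed

text \<open>
  There is no assumption \<open>Y\<^sub>a \<bottom> A | (C, U)\<close> to appeal to; the identity comes from identifying
  the nested counterfactual with both exposures equal and recognising the law of total
  probability for the factual outcome.
\<close>

lemma same_world_identification:
  "cprob S (\<lambda>\<omega>. YaM S a a \<omega>) (\<lambda>\<omega>. Cv S \<omega> = c) =
   cprob S (\<lambda>\<omega>. Yv S \<omega>) (\<lambda>\<omega>. Av S \<omega> = a \<and> Cv S \<omega> = c)"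
proof -
  have "prob_of S (\<lambda>\<omega>. Yv S \<omega> \<and> Av S \<omega> = a \<and> Cv S \<omega> = c) =
    (\<Sum>m\<in>UNIV. prob_of S (\<lambda>\<omega>. (Yv S \<omega> \<and> Av S \<omega> = a \<and> Cv S \<omega> = c) \<and> Mv S \<omega> = m))"
    by (intro prob_sum_over_values) measurable
  also have "\<dots> = (\<Sum>m\<in>UNIV. prob_of S (\<lambda>\<omega>. Yv S \<omega> \<and> Av S \<omega> = a \<and> Mv S \<omega> = m \<and> Cv S \<omega> = c))"
    by (intro sum.cong refl arg_cong[where f = "measure (Pr S)"]) auto
  finally show ?thesis
    unfolding cross_world_identification by (simp add: joint_outcome_given_mediator cond_prob_def)
qed

lemma prob_outside_u_levels:
  assumes "u \<notin> u_levels S c"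
  shows "prob_of S (\<lambda>\<omega>. Av S \<omega> = a \<and> Mv S \<omega> = m \<and> Cv S \<omega> = c \<and> Uv S \<omega> = u) = 0"
proof (rule prob_null)
  show "prob_of S (\<lambda>\<omega>. Uv S \<omega> = u \<and> Cv S \<omega> = c) = 0"
    using assms prob_C_pos
    by (simp add: u_levels_def cond_prob_def zero_less_divide_iff measure_le_0_iff not_less)
qed auto

lemma u_prob_joint:
  "u_prob S a m c u =
   prob_of S (\<lambda>\<omega>. Av S \<omega> = a \<and> Mv S \<omega> = m \<and> Cv S \<omega> = c \<and> Uv S \<omega> = u) /
   prob_of S (\<lambda>\<omega>. Av S \<omega> = a \<and> Mv S \<omega> = m \<and> Cv S \<omega> = c)"
  by (simp add: u_prob_def cond_prob_def conj_ac)

lemma cprob_outcome_given_mediator: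
  "cprob S (\<lambda>\<omega>. Yv S \<omega>) (\<lambda>\<omega>. Av S \<omega> = a \<and> Mv S \<omega> = m \<and> Cv S \<omega> = c) =
   (\<Sum>u\<in>u_levels S c. outcome_prob S a m c u * u_prob S a m c u)"
proof -
  have "(\<Sum>u\<in>u_levels S c. outcome_prob S a m c u * u_prob S a m c u) =
        (\<Sum>u\<in>UNIV. outcome_prob S a m c u * u_prob S a m c u)"
    by (intro sum.mono_neutral_left) (auto simp: u_prob_joint prob_outside_u_levels)
  thus ?thesis
    by (simp add: cond_prob_def joint_outcome_given_mediator u_prob_joint sum_divide_distrib)
qed

lemma u_prob_nonneg: "0 \<le> u_prob S a m c u"
  by (simp add: u_prob_def cond_prob_def)

lemma prob_AMC_pos:
  assumes "m \<in> m_levels S c"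
  shows "prob_of S (\<lambda>\<omega>. Av S \<omega> = a \<and> Mv S \<omega> = m \<and> Cv S \<omega> = c) > 0"
proof -
  have "cprob S (\<lambda>\<omega>. Mv S \<omega> = m) (\<lambda>\<omega>. Av S \<omega> = a \<and> Cv S \<omega> = c) > 0"
    using assms mediation_model.assms[OF mediation_model_axioms]
    by (cases a) (auto simp: m_levels_def assumptions_def positivity_def)
  thus ?thesis by (auto simp: cond_prob_def zero_less_divide_iff conj_ac)
qed

lemma sum_u_prob:
  assumes "m \<in> m_levels S c"
  shows "(\<Sum>u\<in>u_levels S c. u_prob S a m c u) = 1"
proof -
  let ?n = "prob_of S (\<lambda>\<omega>. Av S \<omega> = a \<and> Mv S \<omega> = m \<and> Cv S \<omega> = c)"
  have "?n = (\<Sum>u\<in>UNIV.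
      prob_of S (\<lambda>\<omega>. (Av S \<omega> = a \<and> Mv S \<omega> = m \<and> Cv S \<omega> = c) \<and> Uv S \<omega> = u))"
    by (intro prob_sum_over_values) measurable
  hence "(\<Sum>u\<in>UNIV. u_prob S a m c u) = 1"
    using prob_AMC_pos[OF assms, of a] by (simp add: u_prob_joint flip: sum_divide_distrib)
  moreover have "(\<Sum>u\<in>u_levels S c. u_prob S a m c u) = (\<Sum>u\<in>UNIV. u_prob S a m c u)"
    by (intro sum.mono_neutral_left) (auto simp: u_prob_joint prob_outside_u_levels)
  ultimately show ?thesis by simp
qed

text \<open>
  The form in which the effect is compared with the bound: the inner sum is the mean of the
  exposed outcome probability under the law of \<open>U\<close> among the unexposed, whereas in
  \<open>cprob_outcome_given_mediator\<close> for \<open>a = True\<close> it is taken under the law among the exposed.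
\<close>

lemma nde_rd_identification:
  "nde_rd S c =
   (\<Sum>m\<in>m_levels S c. cprob S (\<lambda>\<omega>. Mv S \<omega> = m) (\<lambda>\<omega>. \<not> Av S \<omega> \<and> Cv S \<omega> = c) *
      (\<Sum>u\<in>u_levels S c. outcome_prob S True m c u * u_prob S False m c u)) -
   cprob S (\<lambda>\<omega>. Yv S \<omega>) (\<lambda>\<omega>. \<not> Av S \<omega> \<and> Cv S \<omega> = c)"
proof -
  let ?a = "prob_of S (\<lambda>\<omega>. \<not> Av S \<omega> \<and> Cv S \<omega> = c)"
  let ?am = "\<lambda>m. prob_of S (\<lambda>\<omega>. \<not> Av S \<omega> \<and> Mv S \<omega> = m \<and> Cv S \<omega> = c)"
  let ?amu = "\<lambda>m u. prob_of S (\<lambda>\<omega>. \<not> Av S \<omega> \<and> Mv S \<omega> = m \<and> Cv S \<omega> = c \<and> Uv S \<omega> = u)"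
  let ?w = "\<lambda>m. cprob S (\<lambda>\<omega>. Mv S \<omega> = m) (\<lambda>\<omega>. \<not> Av S \<omega> \<and> Cv S \<omega> = c)"
  have w: "?w m = ?am m / ?a" for m by (simp add: cond_prob_def conj_ac)
  have inner: "(\<Sum>u\<in>UNIV. outcome_prob S True m c u * ?amu m u) / ?a =
      ?w m * (\<Sum>u\<in>u_levels S c. outcome_prob S True m c u * u_prob S False m c u)" for m
  proof (cases "?am m = 0")
    case True
    have "?amu m u = 0" for u by (rule prob_null[OF True]) auto
    thus ?thesis using True by (simp add: w)
  next
    case False
    have "(\<Sum>u\<in>UNIV. outcome_prob S True m c u * ?amu m u) =
          (\<Sum>u\<in>u_levels S c. outcome_prob S True m c u * ?amu m u)"
      using prob_outside_u_levels[of _ False m] by (intro sum.mono_neutral_right) auto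
    also have "\<dots> = ?am m * (\<Sum>u\<in>u_levels S c. outcome_prob S True m c u * u_prob S False m c u)"
      using False by (simp add: u_prob_joint sum_distrib_left)
    finally show ?thesis by (simp add: w)
  qed
  have "cprob S (\<lambda>\<omega>. YaM S True False \<omega>) (\<lambda>\<omega>. Cv S \<omega> = c) =
    (\<Sum>m\<in>UNIV. ?w m * (\<Sum>u\<in>u_levels S c. outcome_prob S True m c u * u_prob S False m c u))"
    by (simp add: cross_world_identification sum_divide_distrib[of _ UNIV] flip: inner)
  also have "\<dots> = (\<Sum>m\<in>m_levels S c.
      ?w m * (\<Sum>u\<in>u_levels S c. outcome_prob S True m c u * u_prob S False m c u))"
    by (intro sum.mono_neutral_right)
      (auto simp: m_levels_def w zero_less_divide_iff measure_le_0_iff zero_less_measure_iff)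
  finally show ?thesis
    by (simp add: nde_rd_def same_world_identification)
qed

section \<open>The sensitivity parameters bound the bias\<close>

lemma u_levels_nonempty: "m \<in> m_levels S c \<Longrightarrow> u_levels S c \<noteq> {}"
  using sum_u_prob by fastforce

lemma outcome_prob_nonneg: "0 \<le> outcome_prob S a m c u"
  by (simp add: outcome_prob_def cond_prob_def)

lemma rr_au_ge:
  assumes "m \<in> m_levels S c" "u \<in> u_levels S c"
    "\<not> (u_prob S True m c u = 0 \<and> u_prob S False m c u = 0)"
  shows "ereal (u_prob S True m c u) / ereal (u_prob S False m c u) \<le> rr_au S c"
proof -
  let ?R = "\<lambda>m u. ereal (u_prob S True m c u) / ereal (u_prob S False m c u)"
  let ?V = "\<lambda>m. {u \<in> u_levels S c. \<not> (u_prob S True m c u = 0 \<and> u_prob S False m c u = 0)}"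
  have "?R m u \<le> Max (?R m ` ?V m)"
    using assms by (intro Max_ge) auto
  also have "\<dots> \<le> rr_au S c"
    unfolding rr_au_def using assms by (intro Max_ge) auto
  finally show ?thesis .
qed

lemma u_prob_le_rr_au:
  assumes "m \<in> m_levels S c" "u \<in> u_levels S c" "rr_au S c = ereal \<gamma>"
  shows "u_prob S True m c u \<le> \<gamma> * u_prob S False m c u"
proof (cases "u_prob S True m c u = 0 \<and> u_prob S False m c u = 0")
  case False
  with rr_au_ge[OF assms(1,2)] show ?thesis
    unfolding assms(3)
    by (intro le_mult_if_ereal_divide_le) (auto simp: u_prob_nonneg)
qed simp

text \<open>
  The maximum is at least 1 because two probability laws cannot have all ratios below 1. A value
  \<open>u\<close> with positive probability among the exposed shows that the set of admissible ratios is
  nonempty, so that the maximum has its expected meaning.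
\<close>

lemma rr_au_cases:
  assumes "m_levels S c \<noteq> {}"
  obtains "rr_au S c = \<infinity>" | \<gamma> where "rr_au S c = ereal \<gamma>" "1 \<le> \<gamma>"
proof -
  obtain m where m: "m \<in> m_levels S c" using assms by auto
  obtain u where u: "u \<in> u_levels S c" "u_prob S True m c u \<noteq> 0"
    using sum_u_prob[OF m, of True] by (metis sum.neutral zero_neq_one)
  have "0 \<le> ereal (u_prob S True m c u) / ereal (u_prob S False m c u)"
    by (intro zero_le_divide_ereal) (auto simp: u_prob_nonneg)
  also have "\<dots> \<le> rr_au S c" using m u by (intro rr_au_ge) auto
  finally consider "rr_au S c = \<infinity>" | \<gamma> where "rr_au S c = ereal \<gamma>"
    by (cases "rr_au S c") auto
  thus thesis
  proof cases
    case 1 thus thesis by (rule that(1))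
  next
    case (2 \<gamma>)
    have "(\<Sum>u\<in>u_levels S c. u_prob S True m c u) \<le> (\<Sum>u\<in>u_levels S c. \<gamma> * u_prob S False m c u)"
      using u_prob_le_rr_au[OF m _ 2] by (intro sum_mono)
    also have "\<dots> = \<gamma>" using sum_u_prob[OF m] by (simp flip: sum_distrib_left)
    finally show thesis using 2 sum_u_prob[OF m] by (intro that(2)) auto
  qed
qed

lemma rr_uy_ge:
  assumes "m \<in> m_levels S c"
  defines "hi \<equiv> Max (outcome_prob S True m c ` u_levels S c)"
    and "lo \<equiv> Min (outcome_prob S True m c ` u_levels S c)"
  shows "(if hi = 0 \<and> lo = 0 then 1 else ereal hi / ereal lo) \<le> rr_uy S c"
  unfolding rr_uy_def hi_def lo_def Let_def using assms(1) by (intro Max_ge) auto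

text \<open>
  A ratio \<open>0 / 0\<close> arises only if the outcome probability vanishes for all \<open>u\<close>, so reading it as 1 is
  harmless: the comparison of any two values is then trivial.
\<close>

lemma rr_uy_cases:
  assumes "m \<in> m_levels S c"
  obtains "rr_uy S c = \<infinity>"
  | \<delta> where "rr_uy S c = ereal \<delta>" "1 \<le> \<delta>"
      "\<And>m u v. m \<in> m_levels S c \<Longrightarrow> u \<in> u_levels S c \<Longrightarrow> v \<in> u_levels S c \<Longrightarrow>
         outcome_prob S True m c u \<le> \<delta> * outcome_prob S True m c v"
proof -
  define hi lo where "hi m = Max (outcome_prob S True m c ` u_levels S c)"
    and "lo m = Min (outcome_prob S True m c ` u_levels S c)" for m
  have hi: "outcome_prob S True m c u \<le> hi m" and lo: "lo m \<le> outcome_prob S True m c u"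
    if "u \<in> u_levels S c" for m u
    using that by (auto simp: hi_def lo_def)
  have nonneg: "0 \<le> lo m" "lo m \<le> hi m" if m: "m \<in> m_levels S c" for m
  proof -
    have "lo m \<in> outcome_prob S True m c ` u_levels S c"
      unfolding lo_def using u_levels_nonempty[OF m] by (intro Min_in) auto
    thus "0 \<le> lo m" "lo m \<le> hi m" using hi outcome_prob_nonneg by auto
  qed
  have ge: "(if hi m = 0 \<and> lo m = 0 then 1 else ereal (hi m) / ereal (lo m)) \<le> rr_uy S c"
    if "m \<in> m_levels S c" for m
    unfolding hi_def lo_def by (rule rr_uy_ge[OF that])
  have "1 \<le> (if hi m = 0 \<and> lo m = 0 then 1 else ereal (hi m) / ereal (lo m))"
    using nonneg[OF assms] by (cases "lo m = 0") (auto simp: one_ereal_def)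
  from this and ge[OF assms] have one: "1 \<le> rr_uy S c" by (rule order_trans)
  show thesis
  proof (cases "rr_uy S c")
    case (real \<delta>)
    have \<delta>: "1 \<le> \<delta>" using one real by (simp add: one_ereal_def)
    have "outcome_prob S True m c u \<le> \<delta> * outcome_prob S True m c v"
      if m: "m \<in> m_levels S c" and uv: "u \<in> u_levels S c" "v \<in> u_levels S c" for m u v
    proof -
      have "hi m \<le> \<delta> * lo m"
      proof (cases "hi m = 0 \<and> lo m = 0")
        case False
        with ge[OF m] nonneg[OF m] real show ?thesis
          by (intro le_mult_if_ereal_divide_le) auto
      qed simp
      also have "\<dots> \<le> \<delta> * outcome_prob S True m c v"
        using \<delta> lo[OF uv(2)] by (intro mult_left_mono) auto
      finally show ?thesis using hi[OF uv(1), of m] by linarith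
    qed
    with real \<delta> show thesis by (intro that(2))
  qed (use one that(1) in auto)
qed

text \<open>
  One factor \<open>b\<close> serves all mediator levels, since the sensitivity parameters are maxima over
  them. The degenerate cases use half of the argument each: with only \<open>\<delta>\<close> finite, any two values
  of \<open>q\<close>, hence any two means, differ by a factor of at most \<open>\<delta>\<close>; with only \<open>\<gamma>\<close> finite, the
  weights do by at most \<open>\<gamma>\<close>.
\<close>

lemma bf_cases:
  assumes "m_levels S c \<noteq> {}"
  obtains "bf S c = \<infinity>"
  | b where "bf S c = ereal b" "0 < b"
      "\<And>m. m \<in> m_levels S c \<Longrightarrow>
         (\<Sum>u\<in>u_levels S c. outcome_prob S True m c u * u_prob S True m c u) \<le>
         b * (\<Sum>u\<in>u_levels S c. outcome_prob S True m c u * u_prob S False m c u)"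
proof -
  define E where "E a m = (\<Sum>u\<in>u_levels S c. outcome_prob S True m c u * u_prob S a m c u)" for a m
  note sums = sum_u_prob u_prob_nonneg outcome_prob_nonneg u_levels_nonempty
  obtain m0 where m0: "m0 \<in> m_levels S c" using assms by auto
  show thesis
  proof (rule rr_au_cases[OF assms]; rule rr_uy_cases[OF m0])
    assume "rr_au S c = \<infinity>" "rr_uy S c = \<infinity>"
    thus thesis by (intro that(1)) (simp add: bf_def)
  next
    fix \<delta>
    assume au: "rr_au S c = \<infinity>" and uy: "rr_uy S c = ereal \<delta>" "1 \<le> \<delta>"
      "\<And>m u v. m \<in> m_levels S c \<Longrightarrow> u \<in> u_levels S c \<Longrightarrow> v \<in> u_levels S c \<Longrightarrow>
         outcome_prob S True m c u \<le> \<delta> * outcome_prob S True m c v"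
    have "E True m \<le> \<delta> * E False m" if m: "m \<in> m_levels S c" for m
    proof -
      have "E True m * 1 \<le> \<delta> * outcome_prob S True m c v" if "v \<in> u_levels S c" for v
        unfolding E_def mult_1_right using sums m uy that by (intro mean_le_upper_bound) auto
      hence "(\<Sum>v\<in>u_levels S c. E True m * u_prob S False m c v) \<le>
            (\<Sum>v\<in>u_levels S c. (\<delta> * outcome_prob S True m c v) * u_prob S False m c v)"
        by (intro sum_mono mult_right_mono) (auto simp: u_prob_nonneg)
      also have "(\<Sum>v\<in>u_levels S c. E True m * u_prob S False m c v) = E True m"
        using sum_u_prob[OF m] by (simp flip: sum_distrib_left)
      finally show ?thesis by (simp add: E_def[of False] sum_distrib_left mult.assoc)
    qed
    with au uy show thesis by (intro that(2)[of \<delta>]) (auto simp: bf_def E_def)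
  next
    fix \<gamma>
    assume au: "rr_au S c = ereal \<gamma>" "1 \<le> \<gamma>" and uy: "rr_uy S c = \<infinity>"
    have "E True m \<le> \<gamma> * E False m" if m: "m \<in> m_levels S c" for m
    proof -
      have "E True m \<le> (\<Sum>u\<in>u_levels S c. outcome_prob S True m c u * (\<gamma> * u_prob S False m c u))"
        unfolding E_def using u_prob_le_rr_au[OF m _ au(1)] outcome_prob_nonneg
        by (intro sum_mono mult_left_mono) auto
      thus ?thesis by (simp add: E_def[of False] sum_distrib_left mult_ac)
    qed
    with au uy show thesis by (intro that(2)[of \<gamma>]) (auto simp: bf_def E_def)
  next
    fix \<gamma> \<delta>
    assume au: "rr_au S c = ereal \<gamma>" "1 \<le> \<gamma>" and uy: "rr_uy S c = ereal \<delta>" "1 \<le> \<delta>"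
      "\<And>m u v. m \<in> m_levels S c \<Longrightarrow> u \<in> u_levels S c \<Longrightarrow> v \<in> u_levels S c \<Longrightarrow>
         outcome_prob S True m c u \<le> \<delta> * outcome_prob S True m c v"
    let ?b = "\<gamma> * \<delta> / (\<gamma> + \<delta> - 1)"
    have "bf S c = ereal ?b" "0 < ?b"
      using au uy by (auto simp: bf_def one_ereal_def)
    moreover have "E True m \<le> ?b * E False m" if m: "m \<in> m_levels S c" for m
    proof -
      have "(\<gamma> + \<delta> - 1) * E True m \<le> \<gamma> * \<delta> * E False m"
        unfolding E_def
        using sum_u_prob[OF m] u_prob_nonneg u_levels_nonempty[OF m] m au uy u_prob_le_rr_au[OF m _ au(1)]
        by (intro bounding_factor_inequality) auto
      thus ?thesis using au uy by (simp add: field_simps)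
    qed
    ultimately show thesis by (intro that(2)[of ?b]) (auto simp: E_def)
  qed
qed

lemma nde_rd_bound_le: "nde_rd_bound S c \<le> ereal (nde_rd S c)"
proof -
  let ?w = "\<lambda>m. cprob S (\<lambda>\<omega>. Mv S \<omega> = m) (\<lambda>\<omega>. \<not> Av S \<omega> \<and> Cv S \<omega> = c)"
  let ?E = "\<lambda>a m. \<Sum>u\<in>u_levels S c. outcome_prob S True m c u * u_prob S a m c u"
  have Y: "cprob S (\<lambda>\<omega>. Yv S \<omega>) (\<lambda>\<omega>. Av S \<omega> \<and> Mv S \<omega> = m \<and> Cv S \<omega> = c) = ?E True m" for m
    using cprob_outcome_given_mediator[of True m] by simp
  have term_le: "ereal (?E True m * ?w m) / bf S c \<le> ereal (?w m * ?E False m)"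
    if m: "m \<in> m_levels S c" for m
  proof -
    have nonneg: "0 \<le> ?w m" "0 \<le> ?E False m"
      by (auto simp: cond_prob_def outcome_prob_nonneg u_prob_nonneg intro!: sum_nonneg)
    from m have "m_levels S c \<noteq> {}" by auto
    thus ?thesis
    proof (rule bf_cases)
      assume "bf S c = \<infinity>"
      thus ?thesis using nonneg by simp
    next
      fix b
      assume b: "bf S c = ereal b" "0 < b"
        "\<And>m. m \<in> m_levels S c \<Longrightarrow> ?E True m \<le> b * ?E False m"
      have "?E True m * ?w m \<le> b * ?E False m * ?w m"
        using b(3)[OF m] nonneg by (intro mult_right_mono)
      thus ?thesis using b by (simp add: pos_divide_le_eq mult_ac)
    qed
  qed
  have "nde_rd_bound S c \<le> (\<Sum>m\<in>m_levels S c. ereal (?w m * ?E False m)) -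
      ereal (cprob S (\<lambda>\<omega>. Yv S \<omega>) (\<lambda>\<omega>. \<not> Av S \<omega> \<and> Cv S \<omega> = c))"
    unfolding nde_rd_bound_def Y using term_le by (intro ereal_minus_mono sum_mono) auto
  also have "\<dots> = ereal (nde_rd S c)" by (simp add: nde_rd_identification)
  finally show ?thesis .
qed

end

section \<open>Sharpness\<close>

text \<open>
  Almost all independences of the extremal example hold for the trivial reason that one of the
  variables is a function of the conditioning ones.
\<close>

lemma cond_indep_if_determined:
  assumes "\<And>\<omega>. \<omega> \<in> space P \<Longrightarrow> X2 \<omega> = h (Z \<omega>)"
  shows "cond_indep P X1 X2 Z"
proof -
  have "{\<omega> \<in> space P. (X1 \<omega> = x \<and> X2 \<omega> = y) \<and> Z \<omega> = z} =
          (if y = h z then {\<omega> \<in> space P. X1 \<omega> = x \<and> Z \<omega> = z} else {})"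
       "{\<omega> \<in> space P. X2 \<omega> = y \<and> Z \<omega> = z} =
          (if y = h z then {\<omega> \<in> space P. Z \<omega> = z} else {})" for x y z
    using assms by auto
  thus ?thesis by (simp add: cond_indep_def cond_prob_def)
qed

lemma cond_indep_commute:
  assumes "cond_indep P X1 X2 Z"
  shows "cond_indep P X2 X1 Z"
  unfolding cond_indep_def
proof (intro allI impI)
  fix x y z
  assume "measure P {\<omega> \<in> space P. Z \<omega> = z} > 0"
  moreover have "cond_prob P (\<lambda>\<omega>. X2 \<omega> = x \<and> X1 \<omega> = y) (\<lambda>\<omega>. Z \<omega> = z) =
      cond_prob P (\<lambda>\<omega>. X1 \<omega> = y \<and> X2 \<omega> = x) (\<lambda>\<omega>. Z \<omega> = z)"
    by (simp only: conj_commute)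
  ultimately show "cond_prob P (\<lambda>\<omega>. X2 \<omega> = x \<and> X1 \<omega> = y) (\<lambda>\<omega>. Z \<omega> = z) =
      cond_prob P (\<lambda>\<omega>. X2 \<omega> = x) (\<lambda>\<omega>. Z \<omega> = z) *
      cond_prob P (\<lambda>\<omega>. X1 \<omega> = y) (\<lambda>\<omega>. Z \<omega> = z)"
    using assms by (simp add: cond_indep_def)
qed

text \<open>Three independent coins: the exposure, the confounder \<open>U\<close>, and the residual randomness of
  the outcome.\<close>

definition extremal_pmf :: "real \<Rightarrow> real \<Rightarrow> (bool \<times> bool \<times> bool) pmf" where
  "extremal_pmf p q =
     pair_pmf (bernoulli_pmf (1 / 2)) (pair_pmf (bernoulli_pmf p) (bernoulli_pmf q))"

text \<open>
  The outcome is certain if \<open>U\<close> holds and otherwise has probability \<open>q\<close>, whatever the exposure and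
  the mediator are; so the effect is 0 and the outcome ratio is \<open>1 / q\<close>. Unexposed subjects have
  mediator \<open>True\<close>. Without \<open>s\<close>, exposed subjects have mediator \<open>True\<close> exactly if \<open>U\<close> holds: among them,
  observing this mediator reveals \<open>U\<close>, which gives the ratio \<open>1 / p\<close> of \<open>U\<close>-probabilities. The flag \<open>s\<close>
  is for ratio 1, which would force \<open>p = 1\<close> and leave no second value of \<open>U\<close> to
  produce the outcome ratio; with \<open>s\<close> the mediator is constant and carries no information about \<open>U\<close>.
\<close>

definition extremal_model :: "real \<Rightarrow> real \<Rightarrow> bool \<Rightarrow> (nat, bool, bool, bool) causal_model" where
  "extremal_model p q s =
     (let A = (\<lambda>\<omega>. fst (from_nat \<omega> :: bool \<times> bool \<times> bool));
          U = (\<lambda>\<omega>. fst (snd (from_nat \<omega> :: bool \<times> bool \<times> bool)));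
          V = (\<lambda>\<omega>. snd (snd (from_nat \<omega> :: bool \<times> bool \<times> bool)));
          W = (\<lambda>\<omega>. U \<omega> \<or> V \<omega>)
      in \<lparr>Pr = measure_pmf (map_pmf to_nat (extremal_pmf p q)),
          Av = A, Yv = W, Mv = (\<lambda>\<omega>. A \<omega> \<longrightarrow> U \<omega> \<or> s), Cv = (\<lambda>_. True), Uv = U,
          Ya = (\<lambda>_. W), Ma = (\<lambda>a \<omega>. a \<longrightarrow> U \<omega> \<or> s), Yam = (\<lambda>_ _. W)\<rparr>)"

text \<open>Turns every probability in the model into a sum of eight explicit weights, on which all
  its properties are checked by computation.\<close>

lemma measure_extremal_model:
  assumes "0 < p" "p < 1" "0 < q" "q \<le> 1"
  shows "measure (Pr (extremal_model p q s)) X =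
    (\<Sum>a\<in>(UNIV :: bool set). \<Sum>u\<in>UNIV. \<Sum>v\<in>UNIV. of_bool (to_nat (a, u, v) \<in> X) *
       (1 / 2 * ((if u then p else 1 - p) * (if v then q else 1 - q))))"
proof -
  have "measure (Pr (extremal_model p q s)) X =
        (\<Sum>x\<in>to_nat -` X. pmf (extremal_pmf p q) x)"
    by (simp add: extremal_model_def Let_def measure_measure_pmf_finite)
  also have "\<dots> = (\<Sum>x\<in>UNIV. of_bool (to_nat x \<in> X) * pmf (extremal_pmf p q) x)"
    by (intro sum.mono_neutral_cong_left) auto
  also have "\<dots> = (\<Sum>a\<in>UNIV. \<Sum>u\<in>UNIV. \<Sum>v\<in>UNIV.
      of_bool (to_nat (a, u, v) \<in> X) * pmf (extremal_pmf p q) (a, u, v))"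
    by (simp only: sum.cartesian_product UNIV_Times_UNIV split_def prod.collapse)
  also have "\<dots> = (\<Sum>a\<in>(UNIV :: bool set). \<Sum>u\<in>UNIV. \<Sum>v\<in>UNIV. of_bool (to_nat (a, u, v) \<in> X) *
       (1 / 2 * ((if u then p else 1 - p) * (if v then q else 1 - q))))"
    using assms by (intro sum.cong refl) (auto simp: extremal_pmf_def pmf_pair)
  finally show ?thesis .
qed

lemma extremal_model_simps:
  "space (Pr (extremal_model p q s)) = UNIV"
  "Av (extremal_model p q s) \<omega> = fst (from_nat \<omega> :: bool \<times> bool \<times> bool)"
  "Uv (extremal_model p q s) \<omega> = fst (snd (from_nat \<omega> :: bool \<times> bool \<times> bool))"
  "Cv (extremal_model p q s) \<omega> = True"
  "Yv (extremal_model p q s) \<omega> \<longleftrightarrow>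
     fst (snd (from_nat \<omega> :: bool \<times> bool \<times> bool)) \<or> snd (snd (from_nat \<omega> :: bool \<times> bool \<times> bool))"
  "Mv (extremal_model p q s) \<omega> \<longleftrightarrow>
     (Av (extremal_model p q s) \<omega> \<longrightarrow> Uv (extremal_model p q s) \<omega> \<or> s)"
  "Ma (extremal_model p q s) a \<omega> \<longleftrightarrow> (a \<longrightarrow> Uv (extremal_model p q s) \<omega> \<or> s)"
  "Ya (extremal_model p q s) a \<omega> = Yv (extremal_model p q s) \<omega>"
  "Yam (extremal_model p q s) a m \<omega> = Yv (extremal_model p q s) \<omega>"
  by (simp_all add: extremal_model_def Let_def)

text \<open>Summing out a coin on which the event does not depend; without these rules the simplifier
  expands the weights into polynomials that no longer cancel in quotients.\<close>

lemma collapse_weights: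
  fixes x t :: real
  shows "x * (1 - t) + x * t = x" "2 * (x * (1 - t)) + 2 * (x * t) = 2 * x"
    "x * (1 - t) / 2 + x * t / 2 = x / 2" "(1 - t) / 2 + t / 2 = 1 / 2"
  by (simp_all add: field_simps)

lemmas extremal_prob =
  cond_prob_def measure_extremal_model extremal_model_simps UNIV_bool collapse_weights

lemma extremal_model_assumptions:
  assumes "0 < p" "p < 1" "0 < q" "q \<le> 1"
  shows "assumptions (extremal_model p q s) True"
proof -
  let ?S = "extremal_model p q s"
  have "prob_space (Pr ?S)"
    by (simp add: extremal_model_def Let_def measure_pmf.prob_space_axioms)
  moreover have "sets (Pr ?S) = UNIV" "space (Pr ?S) = UNIV"
    by (simp_all add: extremal_model_def Let_def)
  ultimately have "random_vars ?S"
    by (simp add: random_vars_def measurable_def)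
  moreover have "consistency ?S"
    by (auto simp: consistency_def extremal_model_simps)
  moreover have "composition ?S"
    by (simp add: composition_def YaM_def extremal_model_simps)
  moreover have "independence_assumptions ?S"
  proof -
    have "cond_indep (Pr ?S) (Yam ?S a m) (Av ?S) (\<lambda>\<omega>. (Cv ?S \<omega>, Uv ?S \<omega>))" for a m
      using assms by (auto simp: cond_indep_def extremal_prob)
    moreover have "cond_indep (Pr ?S) (Yam ?S a m) (Mv ?S) (\<lambda>\<omega>. (Av ?S \<omega>, Cv ?S \<omega>, Uv ?S \<omega>))" for a m
      by (rule cond_indep_if_determined[where h = "\<lambda>(a, c, u). a \<longrightarrow> u \<or> s"])
        (simp add: extremal_model_simps)
    moreover have "cond_indep (Pr ?S) X (Ma ?S a) (\<lambda>\<omega>. (Cv ?S \<omega>, Uv ?S \<omega>))" for X :: "nat \<Rightarrow> bool" and a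
      by (rule cond_indep_if_determined[where h = "\<lambda>(c, u). a \<longrightarrow> u \<or> s"])
        (simp add: extremal_model_simps)
    moreover have "cond_indep (Pr ?S) (Av ?S) (Uv ?S) (Cv ?S)"
      using assms by (auto simp: cond_indep_def extremal_prob)
    ultimately show ?thesis
      unfolding independence_assumptions_def by (blast intro: cond_indep_commute)
  qed
  moreover have "positivity ?S True"
    using assms by (auto simp: positivity_def extremal_prob all_bool_eq)
  ultimately show ?thesis by (simp add: assumptions_def)
qed

lemma extremal_model_values:
  fixes p q :: real and s :: bool
  assumes "0 < p" "p < 1" "0 < q" "q \<le> 1"
  defines "S \<equiv> extremal_model p q s"
  shows "m_levels S True = {True}" "u_levels S True = UNIV"
    "outcome_prob S True True True u = (if u then 1 else q)"
    "u_prob S False True True u = (if u then p else 1 - p)"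
    "u_prob S True True True u =
      (if s then if u then p else 1 - p else if u then 1 else 0)"
    "nde_rd S True = 0"
    "cprob S (\<lambda>\<omega>. Mv S \<omega> = True) (\<lambda>\<omega>. \<not> Av S \<omega> \<and> Cv S \<omega> = True) = 1"
    "cprob S (\<lambda>\<omega>. Yv S \<omega>) (\<lambda>\<omega>. \<not> Av S \<omega> \<and> Cv S \<omega> = True) = p + (1 - p) * q"
    "cprob S (\<lambda>\<omega>. Yv S \<omega>) (\<lambda>\<omega>. Av S \<omega> \<and> Mv S \<omega> = True \<and> Cv S \<omega> = True) =
       (if s then p + (1 - p) * q else 1)"
proof -
  show "m_levels S True = {True}"
  proof -
    have "m \<in> m_levels S True \<longleftrightarrow> m" for m
      using assms(1-4) by (cases s; cases m) (simp_all add: S_def m_levels_def extremal_prob)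
    thus ?thesis by auto
  qed
  show "u_levels S True = UNIV"
  proof -
    have "u \<in> u_levels S True" for u
      using assms(1-4) by (cases u) (simp_all add: S_def u_levels_def extremal_prob)
    thus ?thesis by auto
  qed
  show "outcome_prob S True True True u = (if u then 1 else q)"
    using assms(1-4) by (cases s; cases u) (simp_all add: S_def outcome_prob_def extremal_prob field_simps)
  show "u_prob S False True True u = (if u then p else 1 - p)"
    using assms(1-4) by (cases s; cases u) (simp_all add: S_def u_prob_def extremal_prob)
  show "u_prob S True True True u =
      (if s then if u then p else 1 - p else if u then 1 else 0)"
    using assms(1-4) by (cases s; cases u) (simp_all add: S_def u_prob_def extremal_prob)
  show "nde_rd S True = 0"
    by (simp add: nde_rd_def YaM_def S_def extremal_model_simps)
  show "cprob S (\<lambda>\<omega>. Mv S \<omega> = True) (\<lambda>\<omega>. \<not> Av S \<omega> \<and> Cv S \<omega> = True) = 1"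
    using assms(1-4) by (cases s) (simp_all add: S_def extremal_prob field_simps)
  show "cprob S (\<lambda>\<omega>. Yv S \<omega>) (\<lambda>\<omega>. \<not> Av S \<omega> \<and> Cv S \<omega> = True) = p + (1 - p) * q"
    using assms(1-4) by (cases s) (simp_all add: S_def extremal_prob field_simps)
  show "cprob S (\<lambda>\<omega>. Yv S \<omega>) (\<lambda>\<omega>. Av S \<omega> \<and> Mv S \<omega> = True \<and> Cv S \<omega> = True) =
       (if s then p + (1 - p) * q else 1)"
    using assms(1-4) by (cases s) (simp_all add: S_def extremal_prob field_simps)
qed

lemma extremal_model_rr_uy:
  assumes "0 < p" "p < 1" "0 < q" "q \<le> 1"
  shows "rr_uy (extremal_model p q s) True = ereal (1 / q)"
  using assms by (simp add: rr_uy_def extremal_model_values UNIV_bool Let_def)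

lemma extremal_model_rr_au:
  assumes "0 < p" "p < 1" "0 < q" "q \<le> 1"
  shows "rr_au (extremal_model p q s) True = (if s then 1 else ereal (1 / p))"
proof -
  have "{u \<in> UNIV. \<not> (u_prob (extremal_model p q s) True True True u = 0 \<and>
          u_prob (extremal_model p q s) False True True u = 0)} = UNIV"
    using assms by (auto simp: extremal_model_values)
  thus ?thesis
    using assms by (simp add: rr_au_def extremal_model_values UNIV_bool one_ereal_def max_def)
qed

theorem theorem3:
  shows "(\<forall>(S :: ('w, 'm::finite, 'c::finite, 'u::finite) causal_model) c.
            assumptions S c \<longrightarrow> ereal (nde_rd S c) \<ge> nde_rd_bound S c) \<and>
         (\<forall>\<gamma> \<delta> :: real. \<gamma> \<ge> 1 \<and> \<delta> \<ge> 1 \<longrightarrow>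
            (\<exists>(S :: (nat, bool, bool, bool) causal_model) c.
               assumptions S c \<and> rr_au S c = ereal \<gamma> \<and> rr_uy S c = ereal \<delta> \<and>
               ereal (nde_rd S c) = nde_rd_bound S c))"
proof (intro conjI allI impI)
  fix S :: "('w, 'm::finite, 'c::finite, 'u::finite) causal_model" and c
  assume "assumptions S c"
  then interpret mediation_model S c by unfold_locales
  show "nde_rd_bound S c \<le> ereal (nde_rd S c)" by (rule nde_rd_bound_le)
next
  fix \<gamma> \<delta> :: real
  assume \<gamma>\<delta>: "\<gamma> \<ge> 1 \<and> \<delta> \<ge> 1"
  define s where "s \<longleftrightarrow> \<gamma> = 1"
  (* For \<gamma> = 1 the bounding factor is 1 and U is independent of everything observed before the
     outcome, so any nondegenerate p gives equality. *)
  define p where "p = (if s then 1 / 2 else 1 / \<gamma>)"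
  define q where "q = 1 / \<delta>"
  have pq: "0 < p" "p < 1" "0 < q" "q \<le> 1"
    using \<gamma>\<delta> by (auto simp: p_def q_def s_def)
  let ?S = "extremal_model p q s"
  have rr: "rr_au ?S True = ereal \<gamma>" "rr_uy ?S True = ereal \<delta>"
    unfolding extremal_model_rr_au[OF pq] extremal_model_rr_uy[OF pq]
    using \<gamma>\<delta> by (auto simp: p_def q_def s_def one_ereal_def)
  hence "bf ?S True = ereal (\<gamma> * \<delta> / (\<gamma> + \<delta> - 1))"
    using \<gamma>\<delta> by (simp add: bf_def one_ereal_def)
  moreover have "nde_rd_bound ?S True =
      ereal ((if s then p + (1 - p) * q else 1) * 1) / bf ?S True - ereal (p + (1 - p) * q)"
    by (simp only: nde_rd_bound_def extremal_model_values[OF pq]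
        sum.insert finite.emptyI empty_iff not_False_eq_True sum.empty add_0_right)
  ultimately have "nde_rd_bound ?S True = 0"
    using \<gamma>\<delta> by (cases s) (simp_all add: p_def q_def s_def field_simps)
  with rr show "\<exists>(S :: (nat, bool, bool, bool) causal_model) c.
      assumptions S c \<and> rr_au S c = ereal \<gamma> \<and> rr_uy S c = ereal \<delta> \<and>
      ereal (nde_rd S c) = nde_rd_bound S c"
    using extremal_model_assumptions[OF pq] extremal_model_values(6)[OF pq]
    by (intro exI[of _ ?S] exI[of _ True]) auto
qed

end
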